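(* Let $m \ge 1$ and $n \ge 1$ be integers and let $A = \{0,1,\ldots,m-1\}$. Let $P(X_1,\ldots,X_n) \in \mathbb{R}[X_1,\ldots,X_n]$ be a polynomial that sign represents the parity function over $A^n$, and suppose that the degree of $P$ in each variable $X_i$ is at most $m-1$. Then $P$ has sparsity $m^n$, and for every exponent vector $(i_1,\ldots,i_n)$ with $0 \le i_j \le m-1$, the coefficient of the monomial $\prod_{j=1}^n X_j^{i_j}$ in $P$ has sign $(-1)^{\sum_j i_j}$.
   Context: For $A \subseteq \mathbb{Z}$, the parity function $\mathrm{Par}: A^n \to \{0,1\}$ is $\mathrm{Par}(a_1,\ldots,a_n) = \sum_{i=1}^n a_i \bmod 2$. A polynomial $P \in \mathbb{R}[X_1,\ldots,X_n]$ sign represents a function $f: A^n \to \{0,1\}$ if for every $(a_1,\ldots,a_n) \in A^n$: $f(a)=0 \Rightarrow P(a) > 0$ and $f(a) = 1 \Rightarrow P(a) < 0$. The sparsity of $P$ is the number of monomials with nonzero coefficient when $P$ is written in the standard monomial basis. The degree of $P$ in $X_i$ is the largest exponent of $X_i$ among monomials with nonzero coefficient. *)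

theory Defs
  imports Complex_Main "HOL-Library.Poly_Mapping" "HOL-Library.FuncSet"
begin

text \<open>A real polynomial is a finitely supported map from exponent vectors to
  coefficients; the variables are indexed by natural numbers, and
  \<open>poly_ring n\<close> is the polynomial ring in the variables with indices \<open>1, \<dots>, n\<close>.\<close>

type_synonym rpoly = "(nat \<Rightarrow>\<^sub>0 nat) \<Rightarrow>\<^sub>0 real"

definition poly_ring :: "nat \<Rightarrow> rpoly set" where
  "poly_ring n = {P. \<forall>e \<in> Poly_Mapping.keys P. Poly_Mapping.keys e \<subseteq> {1..n}}"

definition eval_poly :: "rpoly \<Rightarrow> (nat \<Rightarrow> real) \<Rightarrow> real" where
  "eval_poly P x = (\<Sum>e \<in> Poly_Mapping.keys P. Poly_Mapping.lookup P e * (\<Prod>i \<in> Poly_Mapping.keys e. x i ^ Poly_Mapping.lookup e i))"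

definition sparsity :: "rpoly \<Rightarrow> nat" where
  "sparsity P = card (Poly_Mapping.keys P)"

text \<open>The degree of the zero polynomial is taken to be 0.\<close>

definition degree_in :: "rpoly \<Rightarrow> nat \<Rightarrow> nat" where
  "degree_in P i = Max (insert 0 ((\<lambda>e. Poly_Mapping.lookup e i) ` Poly_Mapping.keys P))"

definition parity :: "nat \<Rightarrow> (nat \<Rightarrow> int) \<Rightarrow> int" where
  "parity n a = (\<Sum>i = 1..n. a i) mod 2"

definition sign_represents :: "nat \<Rightarrow> int set \<Rightarrow> rpoly \<Rightarrow> ((nat \<Rightarrow> int) \<Rightarrow> int) \<Rightarrow> bool" where
  "sign_represents n A P f \<longleftrightarrow>
    (\<forall>a \<in> {1..n} \<rightarrow>\<^sub>E A.
      (f a = 0 \<longrightarrow> eval_poly P (\<lambda>i. real_of_int (a i)) > 0) \<and>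
      (f a = 1 \<longrightarrow> eval_poly P (\<lambda>i. real_of_int (a i)) < 0))"

end

theory Submission
  imports Defs "HOL-Computational_Algebra.Polynomial"
begin

text \<open>Lagrange interpolation on a grid expresses the coefficient of \<open>P\<close> at an exponent vector \<open>e\<close>
  as \<open>\<Sum>a. P(a) * (\<Prod>j. c (a j) (e j))\<close>, where \<open>a\<close> ranges over the grid and \<open>c k i\<close> is the
  coefficient of \<open>X^i\<close> in the univariate Lagrange polynomial of the node \<open>k\<close>. If all nodes are
  nonnegative, then \<open>c k i\<close> is zero or has sign \<open>(-1)^(r + i)\<close>, where \<open>r\<close> is the number of nodes
  below \<open>k\<close>. If moreover the sign of \<open>P(a)\<close> is \<open>-1\<close> to the sum of the ranks of the coordinates
  of \<open>a\<close>, then no two terms have opposite signs, and the term of the least grid point is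
  nonzero.\<close>

subsection \<open>Univariate Lagrange polynomials\<close>

definition lagrange_basis :: "'a::field set \<Rightarrow> 'a \<Rightarrow> 'a poly" where
  "lagrange_basis S a = smult (inverse (\<Prod>b \<in> S - {a}. b - a)) (\<Prod>b \<in> S - {a}. [:b, - 1:])"

lemma degree_lagrange_basis_less:
  assumes "finite S" "a \<in> S"
  shows "degree (lagrange_basis S a) < card S"
proof -
  have "degree (lagrange_basis S a) \<le> degree (\<Prod>b \<in> S - {a}. [:b, - 1:])"
    unfolding lagrange_basis_def by (rule degree_smult_le)
  also have "\<dots> \<le> (\<Sum>b \<in> S - {a}. degree [:b, - 1:])"
    using assms(1) by (intro degree_prod_sum_le[unfolded o_def]) simp
  also have "\<dots> = card S - 1"
    using assms by simp
  also have "\<dots> < card S"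
    using assms by (metis card_Diff1_less card_Diff_singleton)
  finally show ?thesis .
qed

lemma poly_lagrange_basis:
  assumes "finite S" "x \<in> S"
  shows "poly (lagrange_basis S a) x = (if x = a then 1 else 0)"
  using assms by (auto simp: lagrange_basis_def poly_prod)

theorem lagrange_interpolation:
  assumes "finite S" "degree p < card S"
  shows "p = (\<Sum>a \<in> S. smult (poly p a) (lagrange_basis S a))"
proof (rule poly_eqI_degree)
  show "poly p x = poly (\<Sum>a \<in> S. smult (poly p a) (lagrange_basis S a)) x" if "x \<in> S" for x
    using assms(1) that by (simp add: poly_sum poly_lagrange_basis if_distrib cong: if_cong)
  show "degree (\<Sum>a \<in> S. smult (poly p a) (lagrange_basis S a)) < card S"
    using assms
    by (intro degree_sum_less le_less_trans[OF degree_smult_le] degree_lagrange_basis_less) auto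
qed (rule assms(2))

lemma sum_power_coeff_lagrange_basis:
  assumes "finite S" "k < card S"
  shows "(\<Sum>a \<in> S. a ^ k * coeff (lagrange_basis S a) i) = (if k = i then 1 else 0)"
proof -
  have "monom 1 k = (\<Sum>a \<in> S. smult (a ^ k) (lagrange_basis S a))"
    using lagrange_interpolation[of S "monom 1 k"] assms by (simp add: poly_monom degree_monom_eq)
  from arg_cong[OF this, of "\<lambda>p. coeff p i"] show ?thesis
    by (simp add: coeff_sum)
qed

subsection \<open>Signs of the coefficients of Lagrange polynomials\<close>

definition rank_in :: "'a::linorder set \<Rightarrow> 'a \<Rightarrow> nat" where
  "rank_in S a = card {b \<in> S. b < a}"

lemma rank_in_image:
  assumes "strict_mono f"
  shows "rank_in (f ` S) (f a) = rank_in S a"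
proof -
  have "{b \<in> f ` S. b < f a} = f ` {b \<in> S. b < a}"
    using assms by (auto simp: strict_mono_less)
  then show ?thesis
    using strict_mono_imp_inj_on[OF assms] by (simp add: rank_in_def card_image inj_on_subset)
qed

lemma coeff_prod_linear:
  fixes c :: "'a::comm_semiring_1"
  assumes "finite B"
  shows "coeff (\<Prod>b \<in> B. [:f b, c:]) i = c ^ i * (\<Sum>T | T \<subseteq> B \<and> card T = i. \<Prod>b \<in> B - T. f b)"
proof -
  have "(\<Prod>b \<in> B. [:f b, c:]) = (\<Prod>b \<in> B. monom c 1 + smult (f b) 1)"
    by (simp add: monom_altdef)
  also have "\<dots> = (\<Sum>T \<in> Pow B. monom c 1 ^ card T * (\<Prod>b \<in> B - T. smult (f b) 1))"
    using assms by (simp add: prod_add)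
  also have "\<dots> = (\<Sum>T \<in> Pow B. monom (c ^ card T * (\<Prod>b \<in> B - T. f b)) (card T))"
    by (intro sum.cong refl)
      (simp add: monom_power prod_smult smult_monom mult.commute del: smult_one)
  finally show ?thesis
    using assms by (simp add: coeff_sum sum.If_cases sum_distrib_left Pow_def Int_def)
qed

lemma prod_eq_sign_mult_abs_prod:
  fixes f :: "'b \<Rightarrow> 'a::linordered_idom"
  assumes "finite B"
  shows "prod f B = (- 1) ^ card {b \<in> B. f b < 0} * \<bar>prod f B\<bar>"
proof -
  have "prod f B = (\<Prod>b \<in> B. (if f b < 0 then - 1 else 1) * \<bar>f b\<bar>)"
    by (intro prod.cong) auto
  also have "\<dots> = (- 1) ^ card {b \<in> B. f b < 0} * \<bar>prod f B\<bar>"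
    using assms by (simp add: prod.distrib prod.If_cases abs_prod Int_def)
  finally show ?thesis .
qed

lemma sign_mult_coeff_lagrange_basis:
  fixes S :: "'a::linordered_field set"
  assumes "finite S"
  shows "(- 1) ^ (rank_in S a + i) * coeff (lagrange_basis S a) i
    = inverse \<bar>\<Prod>b \<in> S - {a}. b - a\<bar> * (\<Sum>T | T \<subseteq> S - {a} \<and> card T = i. \<Prod>b \<in> S - {a} - T. b)"
    (is "_ = _ * ?esym")
proof -
  let ?diffs = "\<Prod>b \<in> S - {a}. b - a"
  have "{b \<in> S - {a}. b - a < 0} = {b \<in> S. b < a}"
    by auto
  then have "?diffs = (- 1) ^ rank_in S a * \<bar>?diffs\<bar>"
    using prod_eq_sign_mult_abs_prod[of "S - {a}" "\<lambda>b. b - a"] assms by (simp add: rank_in_def)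
  then have "inverse ?diffs = (- 1) ^ rank_in S a * inverse \<bar>?diffs\<bar>"
    by (metis inverse_mult_distrib power_inverse inverse_minus_eq inverse_1)
  then have "coeff (lagrange_basis S a) i
      = (- 1) ^ (rank_in S a + i) * (inverse \<bar>?diffs\<bar> * ?esym)"
    using assms by (simp add: lagrange_basis_def coeff_prod_linear power_add mult_ac)
  then show ?thesis
    by (simp flip: mult.assoc power_add add: mult_2[symmetric])
qed

lemma coeff_lagrange_basis_sign_nonneg:
  fixes S :: "'a::linordered_field set"
  assumes "finite S" "\<And>b. b \<in> S \<Longrightarrow> 0 \<le> b"
  shows "0 \<le> (- 1) ^ (rank_in S a + i) * coeff (lagrange_basis S a) i"
  unfolding sign_mult_coeff_lagrange_basis[OF assms(1)]
  using assms(2) by (intro mult_nonneg_nonneg sum_nonneg prod_nonneg) auto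

lemma coeff_lagrange_basis_Min_sign_pos:
  fixes S :: "'a::linordered_field set"
  assumes S: "finite S" "\<And>b. b \<in> S \<Longrightarrow> 0 \<le> b" and "i < card S"
  shows "0 < (- 1) ^ (rank_in S (Min S) + i) * coeff (lagrange_basis S (Min S)) i"
proof -
  let ?B = "S - {Min S}"
  have pos: "0 < b" if "b \<in> ?B" for b
  proof -
    have "0 \<le> Min S"
      using S that by (intro S(2) Min_in) auto
    also have "Min S < b"
      using S(1) that by (metis DiffE Min_le insertI1 order_le_neq_trans)
    finally show ?thesis .
  qed
  have "Min S \<in> S"
    using assms by (intro Min_in) auto
  then have "i \<le> card ?B"
    using assms by simp
  then obtain T where T: "T \<subseteq> ?B" "card T = i"
    by (rule obtain_subset_with_card_n)
  have "0 < (\<Sum>T | T \<subseteq> ?B \<and> card T = i. \<Prod>b \<in> ?B - T. b)"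
    using S(1) T pos less_imp_le[OF pos]
    by (intro sum_pos2[of _ T] prod_pos prod_nonneg) auto
  moreover have "(\<Prod>b \<in> ?B. b - Min S) \<noteq> 0"
    using S(1) by simp
  ultimately show ?thesis
    unfolding sign_mult_coeff_lagrange_basis[OF S(1)] by simp
qed

subsection \<open>Exponent vectors in a box\<close>

definition exponent_box :: "'v set \<Rightarrow> ('v \<Rightarrow> nat) \<Rightarrow> ('v \<Rightarrow>\<^sub>0 nat) set" where
  "exponent_box V N = {e. Poly_Mapping.keys e \<subseteq> V \<and> (\<forall>j \<in> V. Poly_Mapping.lookup e j < N j)}"

lemma poly_mapping_eq_iff_on_support:
  assumes "Poly_Mapping.keys d \<subseteq> V" "Poly_Mapping.keys e \<subseteq> V"
  shows "d = e \<longleftrightarrow> (\<forall>j \<in> V. Poly_Mapping.lookup d j = Poly_Mapping.lookup e j)"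
  using assms by (auto intro!: poly_mapping_eqI) (metis in_keys_iff subsetD)

lemma card_exponent_box:
  assumes "finite V"
  shows "card (exponent_box V N) = (\<Prod>j \<in> V. N j)"
proof -
  let ?vector = "\<lambda>f. Abs_poly_mapping (\<lambda>j. if j \<in> V then f j else 0)"
  have lookup: "Poly_Mapping.lookup (?vector f) = (\<lambda>j. if j \<in> V then f j else 0)"
    for f :: "'a \<Rightarrow> nat"
    using assms by (intro lookup_Abs_poly_mapping) simp
  have "bij_betw (\<lambda>e. restrict (Poly_Mapping.lookup e) V) (exponent_box V N) (\<Pi>\<^sub>E j \<in> V. {..<N j})"
  proof (rule bij_betw_byWitness[where f' = ?vector])
    show "\<forall>e \<in> exponent_box V N. ?vector (restrict (Poly_Mapping.lookup e) V) = e"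
      by (auto intro!: poly_mapping_eqI simp: exponent_box_def lookup in_keys_iff subset_iff)
    show "\<forall>f \<in> \<Pi>\<^sub>E j \<in> V. {..<N j}. restrict (Poly_Mapping.lookup (?vector f)) V = f"
      unfolding lookup by (auto simp: fun_eq_iff PiE_iff extensional_def)
    show "(\<lambda>e. restrict (Poly_Mapping.lookup e) V) ` exponent_box V N \<subseteq> (\<Pi>\<^sub>E j \<in> V. {..<N j})"
      by (auto simp: exponent_box_def)
    show "?vector ` (\<Pi>\<^sub>E j \<in> V. {..<N j}) \<subseteq> exponent_box V N"
      by (auto simp: exponent_box_def lookup in_keys_iff split: if_splits)
  qed
  then show ?thesis
    using assms by (simp add: bij_betw_same_card card_PiE)
qed

lemma lookup_le_degree_in:
  assumes "e \<in> Poly_Mapping.keys P"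
  shows "Poly_Mapping.lookup e i \<le> degree_in P i"
  unfolding degree_in_def using assms by (intro Max_ge) auto

lemma keys_subset_exponent_box:
  assumes "P \<in> poly_ring n" "\<And>i. i \<in> {1..n} \<Longrightarrow> degree_in P i < N i"
  shows "Poly_Mapping.keys P \<subseteq> exponent_box {1..n} N"
  using assms le_less_trans[OF lookup_le_degree_in]
  by (fastforce simp: exponent_box_def poly_ring_def)

subsection \<open>Interpolation on a grid\<close>

lemma eval_poly_eq_sum_prod:
  assumes "finite V" "\<And>d. d \<in> Poly_Mapping.keys P \<Longrightarrow> Poly_Mapping.keys d \<subseteq> V"
  shows "eval_poly P x
    = (\<Sum>d \<in> Poly_Mapping.keys P. Poly_Mapping.lookup P d * (\<Prod>j \<in> V. x j ^ Poly_Mapping.lookup d j))"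
  unfolding eval_poly_def using assms
  by (intro sum.cong refl arg_cong2[where f = "(*)"] prod.mono_neutral_left)
    (auto simp: in_keys_iff)

lemma sum_grid_prod_power_coeff_lagrange_basis:
  fixes S :: "'v \<Rightarrow> 'a::field set"
  assumes V: "finite V" and S: "\<And>j. j \<in> V \<Longrightarrow> finite (S j)"
    and d: "d \<in> exponent_box V (\<lambda>j. card (S j))" and e: "Poly_Mapping.keys e \<subseteq> V"
  shows "(\<Sum>a \<in> Pi\<^sub>E V S. (\<Prod>j \<in> V. a j ^ Poly_Mapping.lookup d j)
      * (\<Prod>j \<in> V. coeff (lagrange_basis (S j) (a j)) (Poly_Mapping.lookup e j)))
    = (if d = e then 1 else 0)"
proof -
  have "(\<Sum>a \<in> Pi\<^sub>E V S. (\<Prod>j \<in> V. a j ^ Poly_Mapping.lookup d j)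
      * (\<Prod>j \<in> V. coeff (lagrange_basis (S j) (a j)) (Poly_Mapping.lookup e j)))
    = (\<Prod>j \<in> V. \<Sum>a \<in> S j. a ^ Poly_Mapping.lookup d j
      * coeff (lagrange_basis (S j) a) (Poly_Mapping.lookup e j))"
    using V S by (simp add: prod_sum_PiE prod.distrib)
  also have "\<dots> = (\<Prod>j \<in> V. if Poly_Mapping.lookup d j = Poly_Mapping.lookup e j then 1 else 0)"
    using S d by (intro prod.cong refl sum_power_coeff_lagrange_basis) (auto simp: exponent_box_def)
  also have "\<dots> = (if \<forall>j \<in> V. Poly_Mapping.lookup d j = Poly_Mapping.lookup e j then 1 else 0)"
    using V by auto
  also have "\<dots> = (if d = e then 1 else 0)"
    using d e by (subst poly_mapping_eq_iff_on_support[of d V]) (auto simp: exponent_box_def)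
  finally show ?thesis .
qed

theorem lookup_eq_sum_eval_poly_grid:
  assumes V: "finite V" and S: "\<And>j. j \<in> V \<Longrightarrow> finite (S j)"
    and P: "Poly_Mapping.keys P \<subseteq> exponent_box V (\<lambda>j. card (S j))"
    and e: "Poly_Mapping.keys e \<subseteq> V"
  shows "Poly_Mapping.lookup P e = (\<Sum>a \<in> Pi\<^sub>E V S. eval_poly P a
    * (\<Prod>j \<in> V. coeff (lagrange_basis (S j) (a j)) (Poly_Mapping.lookup e j)))"
proof -
  let ?l = "Poly_Mapping.lookup" and ?K = "Poly_Mapping.keys P"
  let ?c = "\<lambda>a. \<Prod>j \<in> V. coeff (lagrange_basis (S j) (a j)) (?l e j)"
  have "eval_poly P a = (\<Sum>d \<in> ?K. ?l P d * (\<Prod>j \<in> V. a j ^ ?l d j))" for a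
    using V P by (intro eval_poly_eq_sum_prod) (auto simp: exponent_box_def)
  then have "(\<Sum>a \<in> Pi\<^sub>E V S. eval_poly P a * ?c a)
      = (\<Sum>a \<in> Pi\<^sub>E V S. \<Sum>d \<in> ?K. ?l P d * ((\<Prod>j \<in> V. a j ^ ?l d j) * ?c a))"
    by (simp add: sum_distrib_right mult.assoc)
  also have "\<dots> = (\<Sum>d \<in> ?K. ?l P d * (\<Sum>a \<in> Pi\<^sub>E V S. (\<Prod>j \<in> V. a j ^ ?l d j) * ?c a))"
    by (subst sum.swap) (simp add: sum_distrib_left)
  also have "\<dots> = (\<Sum>d \<in> ?K. ?l P d * (if d = e then 1 else 0))"
    using P
    by (intro sum.cong refl arg_cong2[where f = "(*)"]
        sum_grid_prod_power_coeff_lagrange_basis V S e) auto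
  also have "\<dots> = ?l P e"
    by (simp add: if_distrib in_keys_iff cong: if_cong)
  finally show ?thesis by simp
qed

subsection \<open>Polynomials of alternating sign on a grid\<close>

definition alternating_on_grid :: "'v set \<Rightarrow> ('v \<Rightarrow> real set) \<Rightarrow> (('v \<Rightarrow> real) \<Rightarrow> real) \<Rightarrow> bool" where
  "alternating_on_grid V S f \<longleftrightarrow> (\<forall>a \<in> Pi\<^sub>E V S. sgn (f a) = (- 1) ^ (\<Sum>j \<in> V. rank_in (S j) (a j)))"

lemma sgn_eq_minus_one_power_iff:
  fixes x :: "'a::linordered_idom"
  shows "sgn x = (- 1) ^ k \<longleftrightarrow> 0 < (- 1) ^ k * x"
  by (simp add: minus_one_power_iff sgn_1_pos sgn_1_neg)

lemma sign_mult_lookup_eq_sum_grid: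
  assumes "finite V" "\<And>j. j \<in> V \<Longrightarrow> finite (S j)"
    and "Poly_Mapping.keys P \<subseteq> exponent_box V (\<lambda>j. card (S j))" "Poly_Mapping.keys e \<subseteq> V"
  shows "(- 1) ^ (\<Sum>j \<in> V. Poly_Mapping.lookup e j) * Poly_Mapping.lookup P e
    = (\<Sum>a \<in> Pi\<^sub>E V S. ((- 1) ^ (\<Sum>j \<in> V. rank_in (S j) (a j)) * eval_poly P a)
      * (\<Prod>j \<in> V. (- 1) ^ (rank_in (S j) (a j) + Poly_Mapping.lookup e j)
        * coeff (lagrange_basis (S j) (a j)) (Poly_Mapping.lookup e j)))"
proof -
  let ?rank = "\<lambda>a. \<Sum>j \<in> V. rank_in (S j) (a j)" and ?degree = "\<Sum>j \<in> V. Poly_Mapping.lookup e j"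
  let ?c = "\<lambda>a j. coeff (lagrange_basis (S j) (a j)) (Poly_Mapping.lookup e j)"
  have "(\<Prod>j \<in> V. (- 1) ^ (rank_in (S j) (a j) + Poly_Mapping.lookup e j) * ?c a j)
      = (- 1) ^ ?rank a * (- 1) ^ ?degree * prod (?c a) V" for a
    by (simp add: power_add power_sum prod.distrib)
  then have "((- 1) ^ ?rank a * eval_poly P a)
      * (\<Prod>j \<in> V. (- 1) ^ (rank_in (S j) (a j) + Poly_Mapping.lookup e j) * ?c a j)
      = (- 1) ^ ?degree * (eval_poly P a * prod (?c a) V)" for a
    by (simp add: minus_one_power_iff)
  moreover have "Poly_Mapping.lookup P e = (\<Sum>a \<in> Pi\<^sub>E V S. eval_poly P a * prod (?c a) V)"
    using assms by (rule lookup_eq_sum_eval_poly_grid)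
  ultimately show ?thesis
    by (simp only: sum_distrib_left)
qed

theorem sgn_lookup_if_alternating_on_grid:
  assumes V: "finite V" and S: "\<And>j. j \<in> V \<Longrightarrow> finite (S j)" "\<And>j b. j \<in> V \<Longrightarrow> b \<in> S j \<Longrightarrow> 0 \<le> b"
    and P: "Poly_Mapping.keys P \<subseteq> exponent_box V (\<lambda>j. card (S j))"
    and alternating: "alternating_on_grid V S (eval_poly P)"
    and e: "e \<in> exponent_box V (\<lambda>j. card (S j))"
  shows "sgn (Poly_Mapping.lookup P e) = (- 1) ^ (\<Sum>j \<in> V. Poly_Mapping.lookup e j)"
proof -
  let ?value = "\<lambda>a. (- 1) ^ (\<Sum>j \<in> V. rank_in (S j) (a j)) * eval_poly P a"
  let ?c = "\<lambda>a j. (- 1) ^ (rank_in (S j) (a j) + Poly_Mapping.lookup e j)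
    * coeff (lagrange_basis (S j) (a j)) (Poly_Mapping.lookup e j)"
  have value_pos: "0 < ?value a" if "a \<in> Pi\<^sub>E V S" for a
    using alternating that by (simp add: alternating_on_grid_def sgn_eq_minus_one_power_iff)
  have "0 < (\<Sum>a \<in> Pi\<^sub>E V S. ?value a * (\<Prod>j \<in> V. ?c a j))"
  proof (rule sum_pos2)
    let ?least = "\<lambda>j \<in> V. Min (S j)"
    show "finite (Pi\<^sub>E V S)"
      using V S(1) by (rule finite_PiE)
    have "S j \<noteq> {}" if "j \<in> V" for j
      using e that by (force simp: exponent_box_def)
    then show least: "?least \<in> Pi\<^sub>E V S"
      using S(1) by (intro restrict_PiE_iff[THEN iffD2]) (blast intro: Min_in)
    have "0 < ?c ?least j" if "j \<in> V" for j
      using S e that coeff_lagrange_basis_Min_sign_pos[of "S j"] by (simp add: exponent_box_def)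
    then show "0 < ?value ?least * (\<Prod>j \<in> V. ?c ?least j)"
      by (intro mult_pos_pos[OF value_pos[OF least]] prod_pos) auto
    show "0 \<le> ?value a * (\<Prod>j \<in> V. ?c a j)" if "a \<in> Pi\<^sub>E V S" for a
      using S that
      by (intro mult_nonneg_nonneg[OF less_imp_le[OF value_pos]] prod_nonneg
          coeff_lagrange_basis_sign_nonneg) auto
  qed
  also have "\<dots> = (- 1) ^ (\<Sum>j \<in> V. Poly_Mapping.lookup e j) * Poly_Mapping.lookup P e"
    using e by (intro sign_mult_lookup_eq_sum_grid[OF V S(1) P, symmetric])
      (auto simp: exponent_box_def)
  finally show ?thesis
    by (simp only: sgn_eq_minus_one_power_iff)
qed

corollary keys_eq_exponent_box_if_alternating_on_grid:
  assumes "finite V" "\<And>j. j \<in> V \<Longrightarrow> finite (S j)" "\<And>j b. j \<in> V \<Longrightarrow> b \<in> S j \<Longrightarrow> 0 \<le> b"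
    and "Poly_Mapping.keys P \<subseteq> exponent_box V (\<lambda>j. card (S j))"
    and "alternating_on_grid V S (eval_poly P)"
  shows "Poly_Mapping.keys P = exponent_box V (\<lambda>j. card (S j))"
proof (intro equalityI assms(4) subsetI)
  fix e assume "e \<in> exponent_box V (\<lambda>j. card (S j))"
  with assms have "sgn (Poly_Mapping.lookup P e) = (- 1) ^ (\<Sum>j \<in> V. Poly_Mapping.lookup e j)"
    by (intro sgn_lookup_if_alternating_on_grid)
  then show "e \<in> Poly_Mapping.keys P"
    by (auto simp: in_keys_iff)
qed

subsection \<open>Sign representation of parity\<close>

lemma sgn_eval_poly_if_sign_represents_parity:
  assumes "sign_represents n A P (parity n)" "a \<in> {1..n} \<rightarrow>\<^sub>E A"
    and "even k \<longleftrightarrow> even (\<Sum>j = 1..n. a j)"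
  shows "sgn (eval_poly P (\<lambda>j. real_of_int (a j))) = (- 1) ^ k"
proof (cases "even k")
  case True
  then have "parity n a = 0"
    using assms(3) by (simp add: parity_def)
  with True assms(1,2) show ?thesis
    by (simp add: sign_represents_def)
next
  case False
  then have "parity n a = 1"
    using assms(3) by (simp add: parity_def odd_iff_mod_2_eq_one)
  with False assms(1,2) show ?thesis
    by (simp add: sign_represents_def)
qed

lemma alternating_on_grid_if_sign_represents_parity:
  assumes P: "P \<in> poly_ring n" and sign: "sign_represents n A P (parity n)"
    and rank: "\<And>a. a \<in> A \<Longrightarrow> even (rank_in A a) \<longleftrightarrow> even a"
  shows "alternating_on_grid {1..n} (\<lambda>_. real_of_int ` A) (eval_poly P)"
  unfolding alternating_on_grid_def
proof
  fix x assume x: "x \<in> {1..n} \<rightarrow>\<^sub>E real_of_int ` A"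
  define a where "a = (\<lambda>j \<in> {1..n}. \<lfloor>x j\<rfloor>)"
  have x_eq: "x j = real_of_int (a j)" and a_mem: "a j \<in> A" if "j \<in> {1..n}" for j
    using PiE_mem[OF x that] that by (auto simp: a_def)
  have "a \<in> {1..n} \<rightarrow>\<^sub>E A"
    using a_mem by (auto simp: a_def)
  moreover have "even (\<Sum>j = 1..n. rank_in (real_of_int ` A) (x j)) \<longleftrightarrow> even (\<Sum>j = 1..n. a j)"
    using x_eq a_mem rank by (simp add: even_sum_iff rank_in_image strict_mono_def cong: conj_cong)
  moreover have "eval_poly P x = eval_poly P (\<lambda>j. real_of_int (a j))"
    using P x_eq by (simp add: poly_ring_def eval_poly_eq_sum_prod[of "{1..n}"])
  ultimately show "sgn (eval_poly P x) = (- 1) ^ (\<Sum>j = 1..n. rank_in (real_of_int ` A) (x j))"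
    using sgn_eval_poly_if_sign_represents_parity[OF sign] by simp
qed

lemma rank_in_atLeastAtMost_int:
  fixes a l u :: int
  assumes "a \<in> {l..u}"
  shows "rank_in {l..u} a = nat (a - l)"
proof -
  have "{b \<in> {l..u}. b < a} = {l..<a}"
    using assms by auto
  then show ?thesis
    by (simp add: rank_in_def)
qed

theorem theorem3p5:
  fixes m n :: nat and A :: "int set" and P :: rpoly
  assumes "m \<ge> 1" and "n \<ge> 1"
    and "A = {0..int m - 1}"
    and "P \<in> poly_ring n"
    and "sign_represents n A P (parity n)"
    and "\<And>i. i \<in> {1..n} \<Longrightarrow> degree_in P i \<le> m - 1"
  shows "sparsity P = m ^ n \<and>
    (\<forall>e. Poly_Mapping.keys e \<subseteq> {1..n} \<and> (\<forall>j \<in> {1..n}. Poly_Mapping.lookup e j \<le> m - 1) \<longrightarrow>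
      sgn (Poly_Mapping.lookup P e) = (- 1) ^ (\<Sum>j = 1..n. Poly_Mapping.lookup e j))"
proof -
  let ?S = "real_of_int ` A" and ?E = "exponent_box {1..n} (\<lambda>_. m)"
  have S: "finite ?S" "\<And>b. b \<in> ?S \<Longrightarrow> 0 \<le> b" and card: "card ?S = m"
    using assms(3) by (auto simp: card_image inj_on_def)
  have box: "e \<in> ?E \<longleftrightarrow> Poly_Mapping.keys e \<subseteq> {1..n}
      \<and> (\<forall>j \<in> {1..n}. Poly_Mapping.lookup e j \<le> m - 1)" for e
    using assms(1) by (auto simp: exponent_box_def)
  have keys: "Poly_Mapping.keys P \<subseteq> exponent_box {1..n} (\<lambda>_. card ?S)"
    using assms(1,4) card by (intro keys_subset_exponent_box le_less_trans[OF assms(6)]) auto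
  have "even (rank_in A a) \<longleftrightarrow> even a" if "a \<in> A" for a
    using that by (simp add: assms(3) rank_in_atLeastAtMost_int even_nat_iff)
  with assms(4,5) have alternating: "alternating_on_grid {1..n} (\<lambda>_. ?S) (eval_poly P)"
    by (rule alternating_on_grid_if_sign_represents_parity)
  have "Poly_Mapping.keys P = ?E"
    using keys_eq_exponent_box_if_alternating_on_grid[OF _ S keys alternating] by (simp add: card)
  then have "sparsity P = m ^ n"
    by (simp add: sparsity_def card_exponent_box)
  moreover have "sgn (Poly_Mapping.lookup P e) = (- 1) ^ (\<Sum>j = 1..n. Poly_Mapping.lookup e j)"
    if "e \<in> ?E" for e
    using sgn_lookup_if_alternating_on_grid[OF _ S keys alternating, of e] that by (simp add: card)
  ultimately show ?thesis
    unfolding box by blast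
qed

end
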